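(* Let $(E,\rho)$ be a Polish space, let $p\in[1,\infty)$, and let $\mu$ be a Borel probability measure on $E$ such that $$\sup_{x\in E}\mu(B(x,r))\le\psi(r),\qquad r\ge 0,$$ holds for some increasing function $\psi:[0,\infty)\to[0,\infty)$, where $B(x,r):=\{y\in E:\rho(x,y)<r\}$. Then for any integer $N\ge 1$ and any probability measure $\mu_N$ supported on a set of $N$ points in $E$, $$\mathbb W_p(\mu_N,\mu)\ge 2^{-\frac1p}\,\psi^{-1}\Big(\frac1{2N}\Big),$$ where $\psi^{-1}(s):=\sup\{r\ge 0:\psi(r)\le s\}$ for $s\ge 0$.
   Context: For Borel probability measures $\mu_1,\mu_2$ on $E$, $\mathbb W_p(\mu_1,\mu_2):=\inf_{\pi}\big(\int_{E\times E}\rho(x,y)^p\,\pi(dx,dy)\big)^{1/p}$, where the infimum is over all couplings $\pi$ of $\mu_1$ and $\mu_2$. Convention: $\sup\emptyset:=0$. *)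

theory Defs
  imports "HOL-Probability.Probability"
begin

definition couplings ::
  "'a::topological_space measure \<Rightarrow> 'a measure \<Rightarrow> ('a \<times> 'a) measure set" where
  "couplings \<mu> \<nu> = {\<pi>. prob_space \<pi> \<and> sets \<pi> = sets (borel \<Otimes>\<^sub>M borel) \<and>
     distr \<pi> borel fst = \<mu> \<and> distr \<pi> borel snd = \<nu>}"

text \<open>There is no real-exponent power on \<^typ>\<open>ennreal\<close> in the library.  The value at
  infinity is the right one for \<open>a > 0\<close>, the only case used; also \<open>0 powr a = 0\<close>.\<close>

definition ennreal_powr :: "ennreal \<Rightarrow> real \<Rightarrow> ennreal" where
  "ennreal_powr x a = (if x = \<infinity> then \<infinity> else ennreal (enn2real x powr a))"

text \<open>Extended-valued, since no moment condition is imposed on the measures.\<close>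

definition wasserstein ::
  "real \<Rightarrow> 'a::metric_space measure \<Rightarrow> 'a measure \<Rightarrow> ennreal" where
  "wasserstein p \<mu> \<nu> =
     (INF \<pi>\<in>couplings \<mu> \<nu>.
        ennreal_powr (\<integral>\<^sup>+ z. ennreal (dist (fst z) (snd z) powr p) \<partial>\<pi>) (1 / p))"

text \<open>The supremum is taken in \<^typ>\<open>ennreal\<close>: it is \<open>0\<close> for the empty set and infinite for
  an unbounded set.\<close>

definition gen_inverse :: "(real \<Rightarrow> real) \<Rightarrow> real \<Rightarrow> ennreal" where
  "gen_inverse \<psi> s = (SUP r\<in>{r. 0 \<le> r \<and> \<psi> r \<le> s}. ennreal r)"

end

theory Submission
  imports Defs
begin

text \<open>If \<open>\<psi> r \<le> 1 / (2 N)\<close>, the balls of radius \<open>r\<close> around the \<open>N\<close> support points have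
  total \<open>\<mu>\<close>-mass at most \<open>1/2\<close>, so every coupling must move mass at least \<open>1/2\<close> over a
  distance at least \<open>r\<close>, at cost at least \<open>r powr p / 2\<close>.\<close>

lemma ennreal_powr_mono:
  assumes "x \<le> y" "a \<ge> 0"
  shows "ennreal_powr x a \<le> ennreal_powr y a"
proof (cases "y = \<infinity>")
  case False
  \<comment> \<open>\<open>enn2real\<close> sends \<open>top\<close> to 0, so it is monotone only on
    finite values; both \<open>x\<close> and \<open>y\<close> have to be finite here.\<close>
  then have "y < top" "x \<noteq> \<infinity>"
    using assms by (auto simp: top_unique less_top)
  then show ?thesis
    using False assms
    by (auto simp: ennreal_powr_def intro!: ennreal_leI powr_mono2 enn2real_mono)
qed (simp add: ennreal_powr_def)

text \<open>A Markov-type estimate: the integrand is at least \<open>r powr p\<close> on an event of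
  probability at least 1/2. The integral may be infinite, hence the bound in
  \<open>ennreal\<close>.\<close>

lemma coupling_cost_lower_bound:
  fixes \<mu> \<nu> :: "'a::metric_space measure"
  assumes \<pi>: "\<pi> \<in> couplings \<nu> \<mu>"
    and S: "finite S" "emeasure \<nu> S = 1"
    and half: "measure \<mu> (\<Union>x\<in>S. ball x r) \<le> 1 / 2"
    and "p \<ge> 0" "r \<ge> 0"
  shows "ennreal (r powr p / 2) \<le> (\<integral>\<^sup>+ z. ennreal (dist (fst z) (snd z) powr p) \<partial>\<pi>)"
proof -
  define A where "A = (\<Union>x\<in>S. ball x r)"
  interpret prob_space \<pi>
    using \<pi> by (simp add: couplings_def)
  have sets_\<pi>: "sets \<pi> = sets (borel \<Otimes>\<^sub>M borel)"
    and \<nu>: "\<nu> = distr \<pi> borel fst" and \<mu>: "\<mu> = distr \<pi> borel snd"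
    using \<pi> by (auto simp: couplings_def)
  have space_\<pi>: "space \<pi> = UNIV"
    using sets_eq_imp_space_eq[OF sets_\<pi>] by (simp add: space_pair_measure)
  have fst_meas: "fst \<in> measurable \<pi> borel" and snd_meas: "snd \<in> measurable \<pi> borel"
    by (simp_all add: measurable_cong_sets[OF sets_\<pi> refl])
  have S_borel: "S \<in> sets borel"
    using S(1) by (simp add: finite_imp_closed)
  have A_borel: "A \<in> sets borel"
    by (auto simp: A_def intro: borel_open)
  have fst_S: "prob (fst -` S) = 1"
    using S(2) emeasure_distr[OF fst_meas S_borel] by (simp add: \<nu> space_\<pi> measure_def)
  have snd_A: "prob (snd -` A) \<le> 1 / 2"
    using half measure_distr[OF snd_meas A_borel] by (simp add: \<mu> space_\<pi> A_def)
  have [measurable]: "fst -` S \<in> events" "snd -` A \<in> events"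
    using measurable_sets[OF fst_meas S_borel] measurable_sets[OF snd_meas A_borel]
    by (simp_all add: space_\<pi>)
  \<comment> \<open>The transport from a point of \<open>S\<close> to a point outside all the balls.
    Since \<open>fst -\<close> S\<open>has full mass and\<close>snd -\<open>A\<close> at most half,
    \<open>P\<close> keeps at least half.\<close>
  define P where "P = fst -` S - snd -` A"
  have P: "P \<in> events"
    unfolding P_def by measurable
  have "prob (fst -` S) \<le> prob (P \<union> snd -` A)"
    using P by (intro finite_measure_mono) (auto simp: P_def)
  also have "\<dots> \<le> prob P + prob (snd -` A)"
    using P by (intro measure_Un_le) auto
  finally have "prob P \<ge> 1 / 2"
    using fst_S snd_A by simp
  then have "r powr p / 2 \<le> r powr p * prob P"
    using mult_left_mono[of "1 / 2" "prob P" "r powr p"] by simp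
  then have "ennreal (r powr p / 2) \<le> ennreal (r powr p) * emeasure \<pi> P"
    by (simp add: emeasure_eq_measure flip: ennreal_mult)
  also have "\<dots> = (\<integral>\<^sup>+ z. ennreal (r powr p) * indicator P z \<partial>\<pi>)"
    using P by (simp add: nn_integral_cmult_indicator)
  \<comment> \<open>The balls are open, so leaving all of them means distance at least
    \<open>r\<close> from every point of \<open>S\<close>. Off \<open>P\<close> the left integrand
    vanishes.\<close>
  also have "\<dots> \<le> (\<integral>\<^sup>+ z. ennreal (dist (fst z) (snd z) powr p) \<partial>\<pi>)"
    using assms(5,6)
    by (intro nn_integral_mono)
      (auto simp: P_def A_def indicator_def not_less intro!: ennreal_leI powr_mono2)
  finally show ?thesis .
qed

text \<open>Union bound; as \<open>c\<close> does not depend on the centre, only the cardinality of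
  \<open>S\<close> enters.\<close>

lemma measure_UN_balls_le:
  fixes \<mu> :: "'a::metric_space measure"
  assumes "sets \<mu> = sets borel" "finite S"
    and "\<And>x. emeasure \<mu> (ball x r) \<le> ennreal c" "c \<ge> 0"
  shows "measure \<mu> (\<Union>x\<in>S. ball x r) \<le> real (card S) * c"
proof -
  have "emeasure \<mu> (\<Union>x\<in>S. ball x r) \<le> (\<Sum>x\<in>S. emeasure \<mu> (ball x r))"
    using assms by (intro emeasure_subadditive_finite) auto
  also have "\<dots> \<le> (\<Sum>x\<in>S. ennreal c)"
    using assms by (intro sum_mono) auto
  also have "\<dots> = ennreal (real (card S) * c)"
    using assms by (simp add: ennreal_mult ennreal_of_nat_eq_real_of_nat)
  finally show ?thesis
    using assms by (auto simp: measure_def intro!: enn2real_leI)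
qed

theorem theorem6p4:
  fixes \<mu> \<mu>\<^sub>N :: "'a::polish_space measure"
    and p :: real and \<psi> :: "real \<Rightarrow> real" and N :: nat and S :: "'a set"
  assumes "p \<ge> 1"
    and "prob_space \<mu>" and "sets \<mu> = sets borel"
    and "\<And>r. r \<ge> 0 \<Longrightarrow> \<psi> r \<ge> 0"
    and "mono_on {0..} \<psi>"
    and "\<And>r. r \<ge> 0 \<Longrightarrow> (SUP x. emeasure \<mu> (ball x r)) \<le> ennreal (\<psi> r)"
    and "N \<ge> 1"
    and "prob_space \<mu>\<^sub>N" and "sets \<mu>\<^sub>N = sets borel"
    and "finite S" and "card S = N" and "emeasure \<mu>\<^sub>N S = 1"
  shows "wasserstein p \<mu>\<^sub>N \<mu> \<ge>
    ennreal (2 powr (- (1 / p))) * gen_inverse \<psi> (1 / (2 * real N))"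
proof -
  have bound: "ennreal (2 powr (- (1 / p))) * ennreal r
      \<le> ennreal_powr (\<integral>\<^sup>+ z. ennreal (dist (fst z) (snd z) powr p) \<partial>\<pi>) (1 / p)"
    if \<pi>: "\<pi> \<in> couplings \<mu>\<^sub>N \<mu>" and r: "r \<ge> 0" "\<psi> r \<le> 1 / (2 * real N)" for \<pi> r
  proof -
    have "emeasure \<mu> (ball x r) \<le> ennreal (1 / (2 * real N))" for x
      by (rule order_trans[OF SUP_upper order_trans[OF assms(6)[OF r(1)]]])
        (use r(2) in \<open>auto intro: ennreal_leI\<close>)
    \<comment> \<open>The threshold 1/(2N) is chosen for this: N balls of mass at most 1/(2N) cover
      at most half of the mass.\<close>
    from measure_UN_balls_le[OF assms(3) \<open>finite S\<close> this]
    have half: "measure \<mu> (\<Union>x\<in>S. ball x r) \<le> 1 / 2"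
      using assms(7,11) by simp
    \<comment> \<open>The constant in the theorem is the p-th root of the factor 1/2 in the cost
      bound.\<close>
    have "2 powr (- (1 / p)) * r = (r powr p / 2) powr (1 / p)"
      using assms(1) r(1) by (simp add: powr_divide powr_powr powr_minus_divide)
    then have "ennreal (2 powr (- (1 / p))) * ennreal r = ennreal_powr (ennreal (r powr p / 2)) (1 / p)"
      using r(1) by (simp add: ennreal_powr_def flip: ennreal_mult)
    also have "\<dots> \<le> ennreal_powr (\<integral>\<^sup>+ z. ennreal (dist (fst z) (snd z) powr p) \<partial>\<pi>) (1 / p)"
      using coupling_cost_lower_bound[OF \<pi> assms(10,12) half] assms(1) r(1)
      by (intro ennreal_powr_mono) auto
    finally show ?thesis .
  qed
  \<comment> \<open>With the constant moved inside the supremum, it suffices to compare each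
    admissible \<open>r\<close> with each coupling. An empty set of radii gives 0, and an unbounded
    one is covered by the same comparison.\<close>
  show ?thesis
    unfolding wasserstein_def gen_inverse_def SUP_mult_left_ennreal
    by (intro INF_greatest SUP_least) (auto intro: bound)
qed

end
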